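(* Let $0<\lambda\leq 1$. For any invertible positive operators $A$ and $B$ on a Hilbert space and any positive real number $\alpha$, the following inequalities hold: $$A\sharp_{\lambda}B-\frac{1}{\alpha}\,A\sharp_{\lambda-1}B+\Big(\ln_{\lambda}\frac{1}{\alpha}\Big)A\ \leq\ T_{\lambda}(A\vert B)\ \leq\ \frac{1}{\alpha}B-A-\Big(\ln_{\lambda}\frac{1}{\alpha}\Big)A\sharp_{\lambda}B .$$ Equality holds in the right-hand inequality if and only if $B=\alpha A$. Equality holds in the left-hand inequality if and only if $A=\alpha B$. Moreover, $T_{\lambda}(A\vert B)=0$ is equivalent to $A=B$.
   Context: Operators are bounded linear operators on a Hilbert space, and $X\leq Y$ means that $Y-X$ is positive (semidefinite). For invertible positive operators $A,B$ and a real number $\mu$, $A\sharp_{\mu}B:=A^{1/2}(A^{-1/2}BA^{-1/2})^{\mu}A^{1/2}$ (used here for $\mu=\lambda$ and $\mu=\lambda-1$). For $\lambda\in(0,1]$, the Tsallis relative operator entropy is $T_{\lambda}(A\vert B):=\frac{1}{\lambda}\left(A^{1/2}(A^{-1/2}BA^{-1/2})^{\lambda}A^{1/2}-A\right)=\frac1\lambda(A\sharp_\lambda B-A)$. For a real number $x>0$, $\ln_{\lambda}x:=\frac{x^{\lambda}-1}{\lambda}$.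
   Formalization: The two equality characterizations are stated only for λ<1: at λ=1 all three members equal B−A for all A, B, α (e.g. A=I, B=2I, α=1), so those equivalences fail there; the inequalities and the T_λ=0 clause keep 0<λ≤1. *)

theory Defs
  imports "HOL-Analysis.Analysis" "HOL-Computational_Algebra.Polynomial"
begin

text \<open>
  A complex Hilbert space is presented on top of its underlying real Hilbert space, whose
  inner product is \<open>Re\<close> of the complex one; thus the norm is \<open>sqrt (Re (cinner x x))\<close>.
  Positive definiteness of \<^term>\<open>cinner\<close> comes from \<^class>\<open>real_inner\<close>, completeness from
  \<^class>\<open>banach\<close>. The form is linear in the second argument. The space may be zero.
\<close>

class complex_hilbert_space = real_inner + banach +
  fixes scaleC :: "complex \<Rightarrow> 'a \<Rightarrow> 'a" (infixr "*\<^sub>C" 75)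
    and cinner :: "'a \<Rightarrow> 'a \<Rightarrow> complex"
  assumes scaleC_add_right: "a *\<^sub>C (x + y) = a *\<^sub>C x + a *\<^sub>C y"
    and scaleC_add_left: "(a + b) *\<^sub>C x = a *\<^sub>C x + b *\<^sub>C x"
    and scaleC_scaleC: "a *\<^sub>C b *\<^sub>C x = (a * b) *\<^sub>C x"
    and scaleR_scaleC: "r *\<^sub>R x = complex_of_real r *\<^sub>C x"
    and cinner_commute: "cinner x y = cnj (cinner y x)"
    and cinner_add_right: "cinner x (y + z) = cinner x y + cinner x z"
    and cinner_scaleC_right: "cinner x (a *\<^sub>C y) = a * cinner x y"
    and inner_Re_cinner: "inner x y = Re (cinner x y)"

lemma cinner_scaleC_left: "cinner (a *\<^sub>C x) y = cnj a * cinner x y"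
  by (metis cinner_commute cinner_scaleC_right complex_cnj_mult)

lemma norm_scaleC: "norm (a *\<^sub>C x) = cmod a * norm (x :: 'a :: complex_hilbert_space)"
proof -
  have "inner (a *\<^sub>C x) (a *\<^sub>C x) = Re (a * cnj a * cinner x x)"
    by (simp add: inner_Re_cinner cinner_scaleC_left cinner_scaleC_right mult_ac)
  also have "\<dots> = (cmod a)\<^sup>2 * inner x x"
    unfolding complex_norm_square [symmetric] by (simp add: inner_Re_cinner flip: of_real_power)
  finally show ?thesis
    by (simp add: norm_eq_sqrt_inner real_sqrt_mult)
qed

lemma bounded_linear_scaleC: "bounded_linear (\<lambda>x :: 'a :: complex_hilbert_space. a *\<^sub>C x)"
proof
  show "a *\<^sub>C (r *\<^sub>R x) = r *\<^sub>R (a *\<^sub>C x)" for r and x :: 'a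
    by (simp add: scaleR_scaleC scaleC_scaleC mult.commute)
  show "\<exists>K. \<forall>x :: 'a. norm (a *\<^sub>C x) \<le> norm x * K"
    by (auto simp: norm_scaleC intro!: exI [of _ "cmod a"])
qed (fact scaleC_add_right)

instantiation complex :: complex_hilbert_space
begin

definition scaleC_complex :: "complex \<Rightarrow> complex \<Rightarrow> complex"
  where "scaleC_complex = (*)"

definition cinner_complex :: "complex \<Rightarrow> complex \<Rightarrow> complex"
  where "cinner_complex x y = cnj x * y"

instance
  by standard (simp_all add: scaleC_complex_def cinner_complex_def algebra_simps scaleR_conv_of_real
      inner_complex_def)

end

text \<open>
  The type \<open>'a \<Rightarrow>\<^sub>L 'a\<close> contains all bounded real-linear maps; the operators on the complex
  Hilbert space are those satisfying \<open>clinear_op\<close>.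
\<close>

definition clinear_op :: "('a::complex_hilbert_space \<Rightarrow>\<^sub>L 'a) \<Rightarrow> bool"
  where "clinear_op A \<longleftrightarrow> (\<forall>c x. A (c *\<^sub>C x) = c *\<^sub>C A x)"

definition pos_op :: "('a::complex_hilbert_space \<Rightarrow>\<^sub>L 'a) \<Rightarrow> bool"
  where "pos_op A \<longleftrightarrow> clinear_op A \<and> (\<forall>x. cinner x (A x) \<in> \<real>\<^sub>\<ge>\<^sub>0)"

definition op_le :: "('a::complex_hilbert_space \<Rightarrow>\<^sub>L 'a) \<Rightarrow> ('a \<Rightarrow>\<^sub>L 'a) \<Rightarrow> bool"
    (infix "\<le>\<^sub>o\<^sub>p" 50)
  where "X \<le>\<^sub>o\<^sub>p Y \<longleftrightarrow> pos_op (Y - X)"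

definition invertible_op :: "('a::complex_hilbert_space \<Rightarrow>\<^sub>L 'a) \<Rightarrow> bool"
  where "invertible_op A \<longleftrightarrow>
    (\<exists>C. clinear_op C \<and> A o\<^sub>L C = id_blinfun \<and> C o\<^sub>L A = id_blinfun)"

lift_definition scalar_op :: "complex \<Rightarrow> 'a::complex_hilbert_space \<Rightarrow>\<^sub>L 'a" is scaleC
  by (fact bounded_linear_scaleC)

definition op_spectrum :: "('a::complex_hilbert_space \<Rightarrow>\<^sub>L 'a) \<Rightarrow> complex set"
  where "op_spectrum A = {z. \<not> invertible_op (A - scalar_op z)}"

definition poly_op :: "real poly \<Rightarrow> ('a::complex_hilbert_space \<Rightarrow>\<^sub>L 'a) \<Rightarrow> 'a \<Rightarrow>\<^sub>L 'a"
  where "poly_op p A = (\<Sum>i\<le>degree p. coeff p i *\<^sub>R (((o\<^sub>L) A ^^ i) id_blinfun))"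

text \<open>
  Continuous functional calculus for a self-adjoint operator \<open>A\<close> (whose spectrum is real) and a
  real function \<open>f\<close> continuous on the spectrum: \<open>f(A)\<close> is the common norm limit of \<open>p\<^sub>n(A)\<close> over
  all sequences of real polynomials \<open>p\<^sub>n\<close> converging to \<open>f\<close> uniformly on the spectrum. The value is
  meaningful only for such \<open>A\<close> and \<open>f\<close>.
\<close>

definition op_fun :: "(real \<Rightarrow> real) \<Rightarrow> ('a::complex_hilbert_space \<Rightarrow>\<^sub>L 'a) \<Rightarrow> 'a \<Rightarrow>\<^sub>L 'a"
  where "op_fun f A = (THE C. \<forall>p :: nat \<Rightarrow> real poly.
    uniform_limit {x. complex_of_real x \<in> op_spectrum A} (\<lambda>n. poly (p n)) f sequentially
      \<longrightarrow> (\<lambda>n. poly_op (p n) A) \<longlonglongrightarrow> C)"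

definition op_powr :: "('a::complex_hilbert_space \<Rightarrow>\<^sub>L 'a) \<Rightarrow> real \<Rightarrow> 'a \<Rightarrow>\<^sub>L 'a"
  where "op_powr A \<mu> = op_fun (\<lambda>x. x powr \<mu>) A"

definition op_sharp :: "real \<Rightarrow> ('a::complex_hilbert_space \<Rightarrow>\<^sub>L 'a) \<Rightarrow> ('a \<Rightarrow>\<^sub>L 'a) \<Rightarrow> 'a \<Rightarrow>\<^sub>L 'a"
  where "op_sharp \<mu> A B =
    op_powr A (1/2) o\<^sub>L op_powr (op_powr A (-1/2) o\<^sub>L B o\<^sub>L op_powr A (-1/2)) \<mu> o\<^sub>L op_powr A (1/2)"

definition tsallis_entropy ::
    "real \<Rightarrow> ('a::complex_hilbert_space \<Rightarrow>\<^sub>L 'a) \<Rightarrow> ('a \<Rightarrow>\<^sub>L 'a) \<Rightarrow> 'a \<Rightarrow>\<^sub>L 'a"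
  where "tsallis_entropy l A B = (1/l) *\<^sub>R (op_sharp l A B - A)"

definition ln_tsallis :: "real \<Rightarrow> real \<Rightarrow> real"
  where "ln_tsallis l x = (x powr l - 1) / l"

end

theory Submission
  imports Defs "HOL-Computational_Algebra.Fundamental_Theorem_Algebra"
begin

text \<open>
  With \<open>R = A\<^sup>1\<^sup>/\<^sup>2\<close> and \<open>X = A\<^sup>-\<^sup>1\<^sup>/\<^sup>2 B A\<^sup>-\<^sup>1\<^sup>/\<^sup>2\<close>, every operator in the statement has the form \<open>R f(X) R\<close>:
  the function is \<open>t\<^sup>\<mu>\<close> for \<open>A \<sharp>\<^sub>\<mu> B\<close>, \<open>1\<close> for \<open>A\<close> and \<open>t\<close> for \<open>B\<close>. For
  \<open>\<psi>(y) = y - 1 - (y\<^sup>\<lambda> - 1) / \<lambda> \<ge> 0\<close> the right-hand difference is \<open>f(t) = \<psi>(t / \<alpha>)\<close> and the left-hand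
  one is \<open>f(t) = t\<^sup>\<lambda> \<psi>(1 / (\<alpha> t))\<close>. Since \<open>\<psi>\<close> vanishes only at \<open>1\<close> when \<open>\<lambda> < 1\<close>, equality forces
  \<open>X\<close> to be a scalar. The functional calculus rests on the fact that a real polynomial which is
  nonnegative on the spectrum of a self-adjoint \<open>T\<close> takes a positive value at \<open>T\<close>: the infimum of the
  quadratic form of \<open>p(T)\<close> is a spectral value of \<open>p(T)\<close>, hence a value of \<open>p\<close> on the spectrum of \<open>T\<close>.
\<close>

subsection \<open>Self-adjoint and invertible operators\<close>

text \<open>Symmetry is asked for the real form only: since
  \<open>Im (cinner x y) = inner (\<i> *\<^sub>C x) y\<close>, complex linearity extends it to
  \<open>cinner\<close>.\<close>

definition selfadj_op :: "('a::complex_hilbert_space \<Rightarrow>\<^sub>L 'a) \<Rightarrow> bool"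
  where "selfadj_op T \<longleftrightarrow> clinear_op T \<and> (\<forall>x y. inner x (T y) = inner (T x) y)"

lemma selfadj_opI:
  "clinear_op T \<Longrightarrow> (\<And>x y. inner x (T y) = inner (T x) y) \<Longrightarrow> selfadj_op T"
  by (simp add: selfadj_op_def)

lemma selfadj_op_clinear: "selfadj_op T \<Longrightarrow> clinear_op T"
  by (simp add: selfadj_op_def)

lemma selfadj_opD: "selfadj_op T \<Longrightarrow> inner x (T y) = inner (T x) y"
  by (simp add: selfadj_op_def)

lemma scalar_op_apply [simp]: "scalar_op z x = z *\<^sub>C x"
  by (simp add: scalar_op.rep_eq)

lemma scaleC_zero_left [simp]: "0 *\<^sub>C x = (0 :: 'a::complex_hilbert_space)"
  using scaleR_scaleC [of 0 x] by simp

lemma scaleC_one [simp]: "1 *\<^sub>C x = (x :: 'a::complex_hilbert_space)"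
  using scaleR_scaleC [of 1 x] by simp

lemma scaleC_zero_right [simp]: "a *\<^sub>C 0 = (0 :: 'a::complex_hilbert_space)"
  using norm_scaleC [of a "0 :: 'a"] by simp

lemma scaleC_minus_one [simp]: "(- 1) *\<^sub>C x = - (x :: 'a::complex_hilbert_space)"
  using scaleR_scaleC [of "- 1" x] by simp

lemma scaleC_diff_right: "a *\<^sub>C (x - y) = a *\<^sub>C x - a *\<^sub>C (y :: 'a::complex_hilbert_space)"
  by (metis add_diff_cancel diff_add_cancel scaleC_add_right)

lemma scaleC_scaleR: "a *\<^sub>C r *\<^sub>R x = r *\<^sub>R a *\<^sub>C (x :: 'a::complex_hilbert_space)"
  by (simp add: scaleR_scaleC scaleC_scaleC mult.commute)

lemma inner_scaleC_right: "inner x (a *\<^sub>C y) = Re (a * cinner x y)"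
  by (simp add: inner_Re_cinner cinner_scaleC_right)

lemma inner_scaleC_left: "inner (a *\<^sub>C x) y = inner x (cnj a *\<^sub>C y)"
  by (simp add: inner_Re_cinner cinner_scaleC_right cinner_scaleC_left)

lemma Im_cinner: "Im (cinner x y) = inner (\<i> *\<^sub>C x) y"
  by (simp add: inner_Re_cinner cinner_scaleC_left)

lemma scalar_op_of_real: "scalar_op (complex_of_real r) = r *\<^sub>R id_blinfun"
  by (rule blinfun_eqI) (simp add: scaleR_scaleC blinfun.bilinear_simps)

lemma scalar_op_0 [simp]: "scalar_op 0 = 0"
  by (rule blinfun_eqI) simp

lemma clinear_op_zero [simp]: "clinear_op 0"
  by (simp add: clinear_op_def)

lemma clinear_op_id [simp]: "clinear_op id_blinfun"
  by (simp add: clinear_op_def)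

lemma clinear_op_scalar [simp]: "clinear_op (scalar_op z)"
  by (simp add: clinear_op_def scaleC_scaleC mult.commute)

lemma clinear_op_add: "clinear_op S \<Longrightarrow> clinear_op T \<Longrightarrow> clinear_op (S + T)"
  by (simp add: clinear_op_def blinfun.bilinear_simps scaleC_add_right)

lemma clinear_op_diff: "clinear_op S \<Longrightarrow> clinear_op T \<Longrightarrow> clinear_op (S - T)"
  by (simp add: clinear_op_def blinfun.bilinear_simps scaleC_diff_right)

lemma clinear_op_scaleR: "clinear_op T \<Longrightarrow> clinear_op (r *\<^sub>R T)"
  by (simp add: clinear_op_def blinfun.bilinear_simps scaleC_scaleR)

lemma clinear_op_compose: "clinear_op S \<Longrightarrow> clinear_op T \<Longrightarrow> clinear_op (S o\<^sub>L T)"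
  by (simp add: clinear_op_def)

lemma selfadj_op_zero [simp]: "selfadj_op 0"
  by (simp add: selfadj_op_def)

lemma selfadj_op_id [simp]: "selfadj_op id_blinfun"
  by (simp add: selfadj_op_def)

lemma selfadj_op_add: "selfadj_op S \<Longrightarrow> selfadj_op T \<Longrightarrow> selfadj_op (S + T)"
  by (simp add: selfadj_op_def clinear_op_add blinfun.bilinear_simps inner_simps)

lemma selfadj_op_diff: "selfadj_op S \<Longrightarrow> selfadj_op T \<Longrightarrow> selfadj_op (S - T)"
  by (simp add: selfadj_op_def clinear_op_diff blinfun.bilinear_simps inner_simps)

lemma selfadj_op_scaleR: "selfadj_op T \<Longrightarrow> selfadj_op (r *\<^sub>R T)"
  by (simp add: selfadj_op_def clinear_op_scaleR blinfun.bilinear_simps)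

lemma selfadj_op_conjugate:
  assumes "selfadj_op R" "selfadj_op T"
  shows "selfadj_op (R o\<^sub>L T o\<^sub>L R)"
proof (rule selfadj_opI)
  show "clinear_op (R o\<^sub>L T o\<^sub>L R)"
    using assms by (simp add: clinear_op_compose selfadj_op_clinear)
qed (simp add: selfadj_opD [OF assms(1)] selfadj_opD [OF assms(2)])

text \<open>Multiplication by the imaginary unit commutes with \<open>T\<close> and is skew for the
  real inner product, so the imaginary part equals its own negative.\<close>

lemma cinner_selfadj_real: "selfadj_op T \<Longrightarrow> Im (cinner x (T x)) = 0"
proof -
  assume T: "selfadj_op T"
  have "inner (\<i> *\<^sub>C x) (T x) = inner (\<i> *\<^sub>C T x) x"
    using T by (simp add: selfadj_op_def clinear_op_def)
  also have "\<dots> = inner (T x) ((- \<i>) *\<^sub>C x)"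
    by (simp add: inner_scaleC_left)
  also have "\<dots> = - inner (\<i> *\<^sub>C x) (T x)"
    using scaleC_add_left [of \<i> "- \<i>" x]
    by (metis ab_left_minus add.commute add.right_inverse add_eq_0_iff inner_commute
        inner_minus_right scaleC_zero_left)
  finally show ?thesis
    by (simp add: Im_cinner)
qed

text \<open>This reduces positivity to the real inner product, in which all later estimates are
  carried out.\<close>

lemma pos_op_iff: "pos_op T \<longleftrightarrow> selfadj_op T \<and> (\<forall>x. 0 \<le> inner x (T x))"
proof
  assume T: "pos_op T"
  have re: "0 \<le> inner x (T x)" for x
    using T by (auto simp: pos_op_def complex_nonneg_Reals_iff inner_Re_cinner)
  have im: "inner (\<i> *\<^sub>C x) (T x) = 0" for x
    using T by (auto simp: pos_op_def complex_nonneg_Reals_iff simp flip: Im_cinner)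
  \<comment> \<open>Polarising the vanishing imaginary part gives the symmetry of the real form.\<close>
  have "inner x (T y) = inner (T x) y" for x y
  proof -
    have "Im (cinner (x + \<i> *\<^sub>C y) (T (x + \<i> *\<^sub>C y))) = 0"
      using im by (simp add: Im_cinner)
    moreover have "T (\<i> *\<^sub>C y) = \<i> *\<^sub>C T y"
      using T by (simp add: pos_op_def clinear_op_def)
    ultimately have "inner (\<i> *\<^sub>C x) (\<i> *\<^sub>C T y) + inner (\<i> *\<^sub>C \<i> *\<^sub>C y) (T x) = 0"
      using im [of x] im [of "\<i> *\<^sub>C y"]
      by (simp add: Im_cinner blinfun.bilinear_simps scaleC_add_right inner_simps)
    moreover have "inner (\<i> *\<^sub>C x) (\<i> *\<^sub>C T y) = inner x (T y)"
      by (simp add: inner_scaleC_left scaleC_scaleC)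
    moreover have "inner (\<i> *\<^sub>C \<i> *\<^sub>C y) (T x) = - inner (T x) y"
      by (simp add: scaleC_scaleC inner_commute)
    ultimately show ?thesis
      by linarith
  qed
  then show "selfadj_op T \<and> (\<forall>x. 0 \<le> inner x (T x))"
    using re T by (auto simp: selfadj_op_def pos_op_def)
next
  assume "selfadj_op T \<and> (\<forall>x. 0 \<le> inner x (T x))"
  then show "pos_op T"
    by (auto simp: pos_op_def complex_nonneg_Reals_iff cinner_selfadj_real inner_Re_cinner
        selfadj_op_clinear)
qed

lemma pos_op_selfadj: "pos_op T \<Longrightarrow> selfadj_op T"
  by (simp add: pos_op_iff)

lemma pos_op_inner: "pos_op T \<Longrightarrow> 0 \<le> inner x (T x)"
  by (simp add: pos_op_iff)

lemma pos_op_conjugate: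
  assumes "selfadj_op R" "pos_op T"
  shows "pos_op (R o\<^sub>L T o\<^sub>L R)"
  using assms selfadj_opD [OF assms(1)] by (auto simp: pos_op_iff selfadj_op_conjugate)

section \<open>Invertibility and coercivity\<close>

lemma invertible_op_compose:
  assumes "invertible_op S" "invertible_op T"
  shows "invertible_op (S o\<^sub>L T)"
proof -
  obtain S' T' where S': "clinear_op S'" "S o\<^sub>L S' = id_blinfun" "S' o\<^sub>L S = id_blinfun"
    and T': "clinear_op T'" "T o\<^sub>L T' = id_blinfun" "T' o\<^sub>L T = id_blinfun"
    using assms by (auto simp: invertible_op_def)
  have "S (S' x) = x" "S' (S x) = x" "T (T' x) = x" "T' (T x) = x" for x
    using S' T' by (metis blinfun_apply_blinfun_compose blinfun_apply_id_blinfun)+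
  then show ?thesis
    unfolding invertible_op_def using S' T'
    by (intro exI [of _ "T' o\<^sub>L S'"]) (auto intro!: blinfun_eqI clinear_op_compose)
qed

lemma invertible_op_scalar: "z \<noteq> 0 \<Longrightarrow> invertible_op (scalar_op z)"
  unfolding invertible_op_def
  by (intro exI [of _ "scalar_op (inverse z)"]) (auto intro!: blinfun_eqI simp: scaleC_scaleC)

text \<open>This permits turning an operator by a unit scalar until its real form becomes
  coercive.\<close>

lemma invertible_op_scalar_compose:
  assumes "z \<noteq> 0"
  shows "invertible_op (scalar_op z o\<^sub>L T) \<longleftrightarrow> invertible_op T"
proof
  assume "invertible_op (scalar_op z o\<^sub>L T)"
  with invertible_op_scalar [of "inverse z"]
  have "invertible_op (scalar_op (inverse z) o\<^sub>L (scalar_op z o\<^sub>L T))"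
    using assms by (auto intro: invertible_op_compose)
  also have "scalar_op (inverse z) o\<^sub>L (scalar_op z o\<^sub>L T) = T"
    using assms by (intro blinfun_eqI) (simp add: scaleC_scaleC)
  finally show "invertible_op T" .
qed (simp add: assms invertible_op_compose invertible_op_scalar)

lemma invertible_op_bounded_below:
  assumes "invertible_op T"
  obtains k where "0 < k" "\<And>x. k * norm x \<le> norm (T x)"
proof -
  obtain C where C: "C o\<^sub>L T = id_blinfun"
    using assms by (auto simp: invertible_op_def)
  \<comment> \<open>The summand 1 keeps the constant positive on the zero space, where
    \<open>C\<close> is 0.\<close>
  have pos: "0 < norm C + 1"
    by (simp add: add_nonneg_pos)
  have le: "norm x \<le> (norm C + 1) * norm (T x)" for x
  proof -
    have "norm x = norm (C (T x))"
      using C by (metis blinfun_apply_blinfun_compose blinfun_apply_id_blinfun)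
    also have "\<dots> \<le> norm C * norm (T x)"
      by (rule norm_blinfun)
    also have "\<dots> \<le> (norm C + 1) * norm (T x)"
      by (intro mult_right_mono) auto
    finally show ?thesis .
  qed
  show ?thesis
  proof (rule that)
    show "0 < 1 / (norm C + 1)"
      using pos by simp
    show "1 / (norm C + 1) * norm x \<le> norm (T x)" for x
      using le [of x] pos by (simp add: pos_divide_le_eq mult.commute)
  qed
qed

text \<open>The Lax--Milgram argument: \<open>x \<mapsto> x - t (T x - y)\<close> is a contraction for small \<open>t > 0\<close>.\<close>

lemma coercive_invertible_op:
  fixes T :: "'a::complex_hilbert_space \<Rightarrow>\<^sub>L 'a"
  assumes T: "clinear_op T" and c: "0 < c" and coer: "\<And>x. c * (norm x)\<^sup>2 \<le> inner x (T x)"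
  shows "invertible_op T"
proof -
  define K where "K = norm T + c"
  \<comment> \<open>This \<open>t\<close> minimises the squared contraction factor
    \<open>1 - 2 * t * c + t\<^sup>2 * K\<^sup>2\<close>; the minimum is
    \<open>q\<^sup>2\<close>.\<close>
  define t where "t = c / K\<^sup>2"
  define q where "q = sqrt (1 - c\<^sup>2 / K\<^sup>2)"
  have K: "c \<le> K" "0 < K"
    using c by (auto simp: K_def add_nonneg_pos)
  have t: "0 < t"
    using c K by (simp add: t_def)
  have "c\<^sup>2 \<le> K\<^sup>2"
    using c K by (intro power_mono) auto
  then have q1: "0 \<le> 1 - c\<^sup>2 / K\<^sup>2"
    using K by (simp add: divide_simps)
  have q: "0 \<le> q" "q < 1"
    using q1 c K by (auto simp: q_def)
  have contr: "norm (z - t *\<^sub>R T z) \<le> q * norm z" for z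
  proof -
    have Tz: "norm (T z) \<le> K * norm z"
      using norm_blinfun [of T z] c
      by (smt (verit) K_def mult_right_mono norm_ge_zero)
    have "(norm (z - t *\<^sub>R T z))\<^sup>2 = (norm z)\<^sup>2 - 2 * t * inner z (T z) + t\<^sup>2 * (norm (T z))\<^sup>2"
      unfolding power2_norm_eq_inner
      by (simp add: inner_simps inner_commute algebra_simps power2_eq_square)
    also have "\<dots> \<le> (norm z)\<^sup>2 - 2 * t * (c * (norm z)\<^sup>2) + t\<^sup>2 * (K * norm z)\<^sup>2"
      using t coer [of z] Tz by (intro add_mono diff_mono mult_left_mono power_mono) auto
    also have "\<dots> = (1 - c\<^sup>2 / K\<^sup>2) * (norm z)\<^sup>2"
      using K by (simp add: t_def field_simps power2_eq_square)
    also have "\<dots> = (q * norm z)\<^sup>2"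
      using q1 by (simp add: q_def power_mult_distrib)
    finally show ?thesis
      by (rule power2_le_imp_le) (use q in simp)
  qed
  have ex: "\<exists>x. T x = y" for y
  proof -
    have "\<exists>!x. x - t *\<^sub>R (T x - y) = x"
    proof (rule banach_fix_type [OF q], intro allI)
      fix x x'
      have "(x - t *\<^sub>R (T x - y)) - (x' - t *\<^sub>R (T x' - y)) = (x - x') - t *\<^sub>R T (x - x')"
        by (simp add: blinfun.bilinear_simps algebra_simps)
      then show "dist (x - t *\<^sub>R (T x - y)) (x' - t *\<^sub>R (T x' - y)) \<le> q * dist x x'"
        using contr by (simp only: dist_norm)
    qed
    then obtain x where "x - t *\<^sub>R (T x - y) = x"
      by blast
    then have "t *\<^sub>R (T x - y) = 0"
      by (metis add_diff_cancel_left' diff_add_cancel diff_self)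
    then show ?thesis
      using t by auto
  qed
  \<comment> \<open>Coercivity and Cauchy-Schwarz give injectivity and, later, the bound
    \<open>1 / c\<close> for the inverse.\<close>
  have below: "c * norm x \<le> norm (T x)" for x
  proof (cases "x = 0")
    case False
    have "c * (norm x)\<^sup>2 \<le> norm x * norm (T x)"
      using coer [of x] norm_cauchy_schwarz [of x "T x"] by linarith
    then show ?thesis
      using False by (simp add: power2_eq_square mult.left_commute)
  qed simp
  have inj: "T x = T y \<Longrightarrow> x = y" for x y
    using below [of "x - y"] c by (simp add: blinfun.bilinear_simps mult_le_0_iff)
  obtain g where g: "T (g y) = y" for y
    using ex by metis
  have gT: "g (T x) = x" for x
    using inj g by blast
  have lin: "bounded_linear g"
  proof (intro bounded_linear_intro [where K = "1 / c"])
    show "norm (g y) \<le> norm y * (1 / c)" for y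
      using below [of "g y"] c by (simp add: g field_simps)
  qed (rule inj; simp add: g blinfun.bilinear_simps)+
  have "g (a *\<^sub>C y) = a *\<^sub>C g y" for a y
    by (rule inj) (use T in \<open>simp add: clinear_op_def g\<close>)
  then have "clinear_op (Blinfun g)"
    using lin by (simp add: clinear_op_def bounded_linear_Blinfun_apply)
  then show ?thesis
    unfolding invertible_op_def using lin
    by (intro exI [of _ "Blinfun g"])
       (auto intro!: blinfun_eqI simp: bounded_linear_Blinfun_apply g gT)
qed

lemma pos_op_norm_le:
  assumes "pos_op S"
  shows "(norm (S x))\<^sup>2 \<le> norm S * inner x (S x)"
proof -
  have S: "selfadj_op S" "\<And>x. 0 \<le> inner x (S x)"
    using assms by (auto simp: pos_op_iff)
  \<comment> \<open>Cauchy--Schwarz for the semidefinite form \<open>\<langle>x, S y\<rangle>\<close>, read off at \<open>x - s S x\<close>.\<close>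
  define p where "p = inner x (S x)"
  define n where "n = (norm (S x))\<^sup>2"
  define r where "r = inner (S x) (S (S x))"
  have r: "r \<le> norm S * n"
  proof -
    have "r \<le> norm (S x) * norm (S (S x))"
      unfolding r_def by (rule norm_cauchy_schwarz)
    also have "\<dots> \<le> norm (S x) * (norm S * norm (S x))"
      by (intro mult_left_mono norm_blinfun) auto
    finally show ?thesis
      by (simp add: n_def power2_eq_square mult_ac)
  qed
  have quad: "0 \<le> p - 2 * s * n + s\<^sup>2 * r" for s
  proof -
    have "inner (x - s *\<^sub>R S x) (S (x - s *\<^sub>R S x)) = p - 2 * s * n + s\<^sup>2 * r"
      using selfadj_opD [OF S(1), of x "S x"]
      by (simp add: p_def n_def r_def blinfun.bilinear_simps inner_simps dot_square_norm
          algebra_simps power2_eq_square)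
    then show ?thesis
      using S(2) by metis
  qed
  show ?thesis
  proof (cases "norm S = 0")
    case False
    \<comment> \<open>With \<open>r \<le> norm S * n\<close>, the quadratic is at most
      \<open>p - 2 * s * n + s\<^sup>2 * norm S * n\<close>, which is smallest at
      \<open>s = 1 / norm S\<close>.\<close>
    have "n * (1 / norm S) \<ge> (1 / norm S)\<^sup>2 * r"
      using mult_left_mono [OF r, of "(1 / norm S)\<^sup>2"] False
      by (simp add: power2_eq_square)
    with quad [of "1 / norm S"] have "n * (1 / norm S) \<le> p"
      by simp
    then show ?thesis
      using False by (simp add: field_simps n_def p_def)
  qed simp
qed

text \<open>Converse of the Lax-Milgram statement for positive operators: the lower bound on
  \<open>norm (S x)\<close> passes to the quadratic form through
  \<open>pos_op_norm_le\<close>.\<close>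

lemma pos_invertible_coercive:
  assumes "pos_op S" "invertible_op S"
  obtains c where "0 < c" "\<And>x. c * (norm x)\<^sup>2 \<le> inner x (S x)"
proof -
  obtain k where k: "0 < k" "\<And>x. k * norm x \<le> norm (S x)"
    using invertible_op_bounded_below [OF assms(2)] by blast
  have "k\<^sup>2 / (norm S + 1) * (norm x)\<^sup>2 \<le> inner x (S x)" for x
  proof -
    have "k\<^sup>2 * (norm x)\<^sup>2 \<le> (norm (S x))\<^sup>2"
      using power_mono [OF k(2) [of x], of 2] k(1) by (simp add: power_mult_distrib)
    also have "\<dots> \<le> norm S * inner x (S x)"
      by (rule pos_op_norm_le [OF assms(1)])
    also have "\<dots> \<le> (norm S + 1) * inner x (S x)"
      using pos_op_inner [OF assms(1)] by (intro mult_right_mono) auto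
    finally show ?thesis
      by (simp add: field_simps add_pos_nonneg)
  qed
  moreover have "0 < k\<^sup>2 / (norm S + 1)"
    using k(1) by (simp add: add_nonneg_pos)
  ultimately show ?thesis
    using that by blast
qed

text \<open>The infimum of the quadratic form of a self-adjoint operator belongs to the spectrum.\<close>

lemma selfadj_lower_bound:
  fixes T :: "'a::complex_hilbert_space \<Rightarrow>\<^sub>L 'a"
  assumes T: "selfadj_op T" and inv: "\<And>t. t < a \<Longrightarrow> invertible_op (T - t *\<^sub>R id_blinfun)"
  shows "a * (norm x)\<^sup>2 \<le> inner x (T x)"
proof (rule ccontr)
  assume neg: "\<not> ?thesis"
  then have x: "x \<noteq> 0"
    by auto
  define M where "M = {inner u (T u) |u. norm u = 1}"
  have scale: "inner y (T y) / (norm y)\<^sup>2 \<in> M" if "y \<noteq> 0" for y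
    unfolding M_def using that
    by (auto intro!: exI [of _ "y /\<^sub>R norm y"] simp: blinfun.bilinear_simps field_simps power2_eq_square)
  have bdd: "bdd_below M"
  proof (rule bdd_belowI [of _ "- norm T"])
    fix z assume "z \<in> M"
    then obtain u where "z = inner u (T u)" "norm u = 1"
      by (auto simp: M_def)
    then show "- norm T \<le> z"
      using norm_blinfun [of T u] Cauchy_Schwarz_ineq2 [of u "T u"] by auto
  qed
  define m where "m = Inf M"
  have m: "m \<le> z" if "z \<in> M" for z
    unfolding m_def using that bdd by (rule cInf_lower)
  have "inner x (T x) / (norm x)\<^sup>2 < a"
    using neg x by (simp add: field_simps)
  then have ma: "m < a"
    using m [OF scale [OF x]] by linarith
  have low: "m * (norm y)\<^sup>2 \<le> inner y (T y)" for y
    using m [OF scale [of y]] by (cases "y = 0") (auto simp: field_simps)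
  \<comment> \<open>\<open>?S\<close> is positive with infimum 0. If \<open>m < a\<close> it is also
    invertible, hence coercive, and the infimum of \<open>M\<close> would exceed
    \<open>m\<close>.\<close>
  let ?S = "T - m *\<^sub>R id_blinfun"
  have Sin: "inner y (?S y) = inner y (T y) - m * (norm y)\<^sup>2" for y
    by (simp add: blinfun.bilinear_simps inner_simps power2_norm_eq_inner)
  have "pos_op ?S"
    unfolding pos_op_iff Sin using low T
    by (auto intro!: selfadj_op_diff selfadj_op_scaleR)
  then obtain c where c: "0 < c" "\<And>y. c * (norm y)\<^sup>2 \<le> inner y (?S y)"
    using pos_invertible_coercive inv [OF ma] by blast
  have "m + c \<le> z" if "z \<in> M" for z
  proof -
    from that obtain u where "z = inner u (T u)" "norm u = 1"
      by (auto simp: M_def)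
    then show ?thesis
      using c(2) [of u] unfolding Sin by auto
  qed
  then have "m + c \<le> m"
    unfolding m_def using scale [OF x] by (intro cInf_greatest) auto
  then show False
    using c(1) by simp
qed

section \<open>Location of the spectrum\<close>

lemma selfadj_spectrum_real:
  assumes T: "selfadj_op T" and z: "z \<in> op_spectrum T"
  shows "z \<in> \<real>"
proof (rule ccontr)
  assume "z \<notin> \<real>"
  then have im: "Im z \<noteq> 0"
    by (simp add: complex_is_Real_iff)
  \<comment> \<open>The form of \<open>T\<close> is real, so after multiplication by plus or minus
    the imaginary unit only the imaginary part of \<open>z\<close> enters the real form of
    \<open>T - z\<close>; the sign makes it positive.\<close>
  define w where "w = \<i> * complex_of_real (sgn (Im z))"
  have w: "w \<noteq> 0"
    using im by (simp add: w_def sgn_if)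
  let ?S = "scalar_op w o\<^sub>L (T - scalar_op z)"
  have "inner x (?S x) = \<bar>Im z\<bar> * (norm x)\<^sup>2" for x
  proof -
    have 1: "cinner x (T x) = of_real (inner x (T x))"
      using cinner_selfadj_real [OF T] by (simp add: complex_eq_iff inner_Re_cinner)
    have 2: "cinner x x = of_real ((norm x)\<^sup>2)"
      using cinner_selfadj_real [OF selfadj_op_id, of x]
      by (simp add: complex_eq_iff power2_norm_eq_inner inner_Re_cinner)
    have "inner x (?S x) = Re (w * (cinner x (T x) - z * cinner x x))"
      by (simp add: blinfun.bilinear_simps scaleC_diff_right inner_simps inner_scaleC_right
          scaleC_scaleC algebra_simps)
    also have "\<dots> = \<bar>Im z\<bar> * (norm x)\<^sup>2"
      unfolding 1 2 by (simp add: w_def abs_sgn algebra_simps)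
    finally show ?thesis .
  qed
  then have "invertible_op ?S"
    using im selfadj_op_clinear [OF T]
    by (intro coercive_invertible_op [of _ "\<bar>Im z\<bar>"] clinear_op_compose clinear_op_diff) auto
  then show False
    using z w by (simp add: invertible_op_scalar_compose op_spectrum_def)
qed

text \<open>Below \<open>a\<close> the operator \<open>T - t\<close> is coercive with constant
  \<open>a - t\<close>; above \<open>b\<close> its negative is coercive with constant
  \<open>t - b\<close>.\<close>

lemma selfadj_spectrum_bounds:
  assumes T: "selfadj_op T" and t: "complex_of_real t \<in> op_spectrum T"
    and lo: "\<And>x. a * (norm x)\<^sup>2 \<le> inner x (T x)" and hi: "\<And>x. inner x (T x) \<le> b * (norm x)\<^sup>2"
  shows "t \<in> {a..b}"
proof -
  have ninv: "\<not> invertible_op (T - t *\<^sub>R id_blinfun)"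
    using t by (simp add: op_spectrum_def scalar_op_of_real)
  have "\<not> t < a"
  proof
    assume "t < a"
    then have "invertible_op (T - t *\<^sub>R id_blinfun)"
      using selfadj_op_clinear [OF T] lo
      by (intro coercive_invertible_op [of _ "a - t"] clinear_op_diff clinear_op_scaleR)
         (auto simp: blinfun.bilinear_simps inner_simps power2_norm_eq_inner algebra_simps)
    then show False using ninv by simp
  qed
  moreover have "\<not> b < t"
  proof
    assume bt: "b < t"
    have "invertible_op (scalar_op (- 1) o\<^sub>L (T - t *\<^sub>R id_blinfun))"
    proof (rule coercive_invertible_op [of _ "t - b"])
      fix x
      have "inner x ((scalar_op (- 1) o\<^sub>L (T - t *\<^sub>R id_blinfun)) x) = t * (norm x)\<^sup>2 - inner x (T x)"
        by (simp add: blinfun.bilinear_simps scaleC_diff_right inner_simps inner_scaleC_right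
            power2_norm_eq_inner flip: inner_Re_cinner)
      then show "(t - b) * (norm x)\<^sup>2 \<le> inner x ((scalar_op (- 1) o\<^sub>L (T - t *\<^sub>R id_blinfun)) x)"
        using hi [of x] by (simp add: algebra_simps)
    qed (use bt selfadj_op_clinear [OF T] in
        \<open>auto intro!: clinear_op_compose clinear_op_diff clinear_op_scaleR\<close>)
    then show False
      using ninv by (simp add: invertible_op_scalar_compose)
  qed
  ultimately show ?thesis by auto
qed

subsection \<open>Polynomials of an operator\<close>

interpretation blinfun_compose: bounded_bilinear "(o\<^sub>L)"
  by (rule bounded_bilinear_blinfun_compose)

lemma poly_op_eq_sum:
  "degree p \<le> n \<Longrightarrow> poly_op p T = (\<Sum>i\<le>n. coeff p i *\<^sub>R (((o\<^sub>L) T ^^ i) id_blinfun))"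
  unfolding poly_op_def by (rule sum.mono_neutral_left) (auto simp: coeff_eq_0)

lemma poly_op_0 [simp]: "poly_op 0 T = 0"
  by (simp add: poly_op_def)

lemma poly_op_pCons: "poly_op (pCons a p) T = a *\<^sub>R id_blinfun + (T o\<^sub>L poly_op p T)"
proof -
  have "poly_op (pCons a p) T
      = (\<Sum>i\<le>Suc (degree p). coeff (pCons a p) i *\<^sub>R (((o\<^sub>L) T ^^ i) id_blinfun))"
    by (intro poly_op_eq_sum degree_pCons_le)
  also have "\<dots> = a *\<^sub>R id_blinfun
      + (\<Sum>i\<le>degree p. coeff p i *\<^sub>R (T o\<^sub>L (((o\<^sub>L) T ^^ i) id_blinfun)))"
    by (simp add: sum.atMost_Suc_shift del: sum.atMost_Suc)
  also have "\<dots> = a *\<^sub>R id_blinfun + (T o\<^sub>L poly_op p T)"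
    by (simp add: poly_op_def blinfun_compose.bilinear_simps)
  finally show ?thesis .
qed

lemma poly_op_add: "poly_op (p + q) T = poly_op p T + poly_op q T"
  by (induction p q rule: poly_induct2)
     (simp_all add: poly_op_pCons blinfun_compose.bilinear_simps scaleR_left_distrib)

lemma poly_op_smult: "poly_op (smult a p) T = a *\<^sub>R poly_op p T"
  by (induction p) (simp_all add: poly_op_pCons blinfun_compose.bilinear_simps scaleR_right_distrib)

lemma poly_op_diff: "poly_op (p - q) T = poly_op p T - poly_op q T"
  using poly_op_add [of "p - q" q T] by simp

lemma poly_op_mult: "poly_op (p * q) T = poly_op p T o\<^sub>L poly_op q T"
  by (induction p)
     (auto intro!: blinfun_eqI simp: poly_op_pCons poly_op_add poly_op_smult blinfun.bilinear_simps)

lemma poly_op_const: "poly_op [:a:] T = a *\<^sub>R id_blinfun"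
  by (simp add: poly_op_pCons)

lemma poly_op_ident: "poly_op [:0, 1:] T = T"
  by (rule blinfun_eqI) (simp add: poly_op_pCons)

text \<open>A product of self-adjoint operators is self-adjoint when they commute; here commutation
  comes from that of polynomial multiplication.\<close>

lemma selfadj_op_poly:
  assumes "selfadj_op T"
  shows "selfadj_op (poly_op p T)"
proof (induction p)
  case (pCons a p)
  have "poly_op p T o\<^sub>L T = T o\<^sub>L poly_op p T"
    by (metis mult.commute poly_op_ident poly_op_mult)
  then have comm: "poly_op p T (T x) = T (poly_op p T x)" for x
    by (metis blinfun_apply_blinfun_compose)
  have "selfadj_op (T o\<^sub>L poly_op p T)"
  proof (rule selfadj_opI)
    show "clinear_op (T o\<^sub>L poly_op p T)"
      using assms pCons.IH by (simp add: clinear_op_compose selfadj_op_clinear)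
  qed (simp add: selfadj_opD [OF assms] selfadj_opD [OF pCons.IH] comm)
  then show ?case
    unfolding poly_op_pCons by (intro selfadj_op_add selfadj_op_scaleR selfadj_op_id)
qed simp

text \<open>Horner's scheme. Complex coefficients allow a polynomial to be split into linear
  factors.\<close>

definition cpoly_op :: "complex poly \<Rightarrow> ('a::complex_hilbert_space \<Rightarrow>\<^sub>L 'a) \<Rightarrow> 'a \<Rightarrow>\<^sub>L 'a"
  where "cpoly_op q T = fold_coeffs (\<lambda>a S. scalar_op a + (T o\<^sub>L S)) q 0"

lemma cpoly_op_0 [simp]: "cpoly_op 0 T = 0"
  by (simp add: cpoly_op_def)

lemma cpoly_op_pCons: "cpoly_op (pCons a q) T = scalar_op a + (T o\<^sub>L cpoly_op q T)"
  by (cases "a = 0 \<and> q = 0") (auto simp: cpoly_op_def)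

lemma cpoly_op_of_real: "cpoly_op (map_poly complex_of_real p) T = poly_op p T"
  by (induction p) (simp_all add: map_poly_pCons cpoly_op_pCons poly_op_pCons scalar_op_of_real)

lemma cpoly_op_add: "cpoly_op (p + q) T = cpoly_op p T + cpoly_op q T"
  by (induction p q rule: poly_induct2)
     (auto intro!: blinfun_eqI simp: cpoly_op_pCons blinfun.bilinear_simps scaleC_add_left)

lemma cpoly_op_smult:
  assumes "clinear_op T"
  shows "cpoly_op (smult a q) T = scalar_op a o\<^sub>L cpoly_op q T"
  using assms
  by (induction q)
     (auto intro!: blinfun_eqI simp: cpoly_op_pCons clinear_op_def blinfun.bilinear_simps
       scaleC_scaleC scaleC_add_right)

text \<open>Complex linearity is what lets the scalar \<open>z\<close> move past
  \<open>T\<close>.\<close>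

lemma cpoly_op_linear_factor:
  assumes "clinear_op T"
  shows "cpoly_op ([:- z, 1:] * q) T = (T - scalar_op z) o\<^sub>L cpoly_op q T"
proof -
  have "cpoly_op ([:- z, 1:] * q) T = cpoly_op (smult (- z) q + pCons 0 q) T"
    by simp
  also have "\<dots> = (scalar_op (- z) o\<^sub>L cpoly_op q T) + (T o\<^sub>L cpoly_op q T)"
    by (simp only: cpoly_op_add cpoly_op_smult [OF assms] cpoly_op_pCons scalar_op_0 add_0_left)
  also have "\<dots> = (T - scalar_op z) o\<^sub>L cpoly_op q T"
  proof (rule blinfun_eqI)
    fix x
    have "(- z) *\<^sub>C y = - (z *\<^sub>C y)" for y :: 'a
      using scaleC_scaleC [of "- 1" z y] by simp
    then show "((scalar_op (- z) o\<^sub>L cpoly_op q T) + (T o\<^sub>L cpoly_op q T)) x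
        = ((T - scalar_op z) o\<^sub>L cpoly_op q T) x"
      by (simp add: blinfun.bilinear_simps)
  qed
  finally show ?thesis .
qed

text \<open>Induction on the degree splits off a root \<open>z\<close>, and \<open>T - z\<close> is
  invertible because \<open>z\<close> lies outside the spectrum. This is one half of the spectral
  mapping theorem.\<close>

lemma cpoly_op_invertible:
  assumes T: "clinear_op T"
  shows "q \<noteq> 0 \<Longrightarrow> (\<And>z. poly q z = 0 \<Longrightarrow> z \<notin> op_spectrum T) \<Longrightarrow> invertible_op (cpoly_op q T)"
proof (induction "degree q" arbitrary: q)
  case 0
  then obtain a where "q = [:a:]" "a \<noteq> 0"
    by (metis degree_eq_zeroE pCons_0_0)
  then show ?case
    by (simp add: cpoly_op_pCons invertible_op_scalar)
next
  case (Suc n)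
  obtain z where z: "poly q z = 0"
    using fundamental_theorem_of_algebra [of q] Suc.hyps(2) by (auto simp: constant_degree)
  then obtain r where r: "q = [:- z, 1:] * r"
    by (auto simp: poly_eq_0_iff_dvd)
  have r0: "r \<noteq> 0"
    using r Suc.prems(1) by auto
  then have "degree q = Suc (degree r)"
    unfolding r by (subst degree_mult_eq) auto
  then have "invertible_op (cpoly_op r T)"
    using Suc.hyps(2) Suc.prems(2) r0 by (intro Suc.hyps(1)) (auto simp: r)
  moreover have "invertible_op (T - scalar_op z)"
    using Suc.prems(2) [OF z] by (simp add: op_spectrum_def)
  ultimately show ?case
    unfolding r cpoly_op_linear_factor [OF T] by (intro invertible_op_compose)
qed

section \<open>Order and norm estimates for polynomials on the spectrum\<close>

definition real_spectrum :: "('a::complex_hilbert_space \<Rightarrow>\<^sub>L 'a) \<Rightarrow> real set"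
  where "real_spectrum T = {x. complex_of_real x \<in> op_spectrum T}"

lemma poly_map_of_real: "poly (map_poly complex_of_real p) (of_real t) = of_real (poly p t)"
  by (induction p) (simp_all add: map_poly_pCons)

text \<open>For \<open>t < 0\<close> the polynomial \<open>p - [:t:]\<close> has no root in the
  spectrum, so \<open>p(T) - t\<close> is invertible and the lower bound 0 applies.\<close>

lemma poly_op_nonneg:
  assumes T: "selfadj_op T" and p: "\<And>t. t \<in> real_spectrum T \<Longrightarrow> 0 \<le> poly p t"
  shows "0 \<le> inner x (poly_op p T x)"
\<comment> \<open>An empty spectrum forces the space to be zero. A nonempty one ensures that
  \<open>p - [:t:]\<close> is not the zero polynomial.\<close>
proof (cases "real_spectrum T = {}")
  case True
  then have "invertible_op (T - t *\<^sub>R id_blinfun)" for t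
    by (auto simp: real_spectrum_def op_spectrum_def scalar_op_of_real)
  then have le: "a * (norm x)\<^sup>2 \<le> inner x (T x)" for a
    using selfadj_lower_bound [OF T] by blast
  have "x = 0"
  proof (rule ccontr)
    assume "x \<noteq> 0"
    then show False
      using le [of "(inner x (T x) + 1) / (norm x)\<^sup>2"] by simp
  qed
  then show ?thesis by simp
next
  case False
  have "invertible_op (poly_op p T - t *\<^sub>R id_blinfun)" if t: "t < 0" for t
  proof -
    let ?q = "map_poly complex_of_real (p - [:t:])"
    have "?q \<noteq> 0"
    proof
      assume "?q = 0"
      then have "p = [:t:]"
        by (simp add: map_poly_eq_0_iff)
      then show False
        using p t False by auto
    qed
    moreover have "z \<notin> op_spectrum T" if z: "poly ?q z = 0" for z
    proof
      assume zT: "z \<in> op_spectrum T"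
      then obtain s where s: "z = of_real s"
        using selfadj_spectrum_real [OF T] Reals_cases by blast
      have "poly ?q z = of_real (poly (p - [:t:]) s)"
        unfolding s by (rule poly_map_of_real)
      then have "poly p s = t"
        using z by simp
      then show False
        using p [of s] zT t by (simp add: real_spectrum_def s)
    qed
    ultimately have "invertible_op (cpoly_op ?q T)"
      using selfadj_op_clinear [OF T] by (intro cpoly_op_invertible)
    then show ?thesis
      by (simp only: cpoly_op_of_real poly_op_diff poly_op_const)
  qed
  from selfadj_lower_bound [OF selfadj_op_poly [OF T] this, of 0 x]
  show ?thesis by simp
qed

text \<open>Positivity of \<open>e\<^sup>2 - p\<^sup>2\<close> at \<open>T\<close>. The estimate
  makes uniform convergence on the spectrum imply norm convergence.\<close>

lemma poly_op_norm_le: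
  assumes T: "selfadj_op T" and e: "0 \<le> e" and p: "\<And>t. t \<in> real_spectrum T \<Longrightarrow> \<bar>poly p t\<bar> \<le> e"
  shows "norm (poly_op p T) \<le> e"
proof (rule norm_blinfun_bound [OF e])
  fix x
  have "0 \<le> inner x (poly_op ([:e\<^sup>2:] - p * p) T x)"
  proof (rule poly_op_nonneg [OF T])
    show "0 \<le> poly ([:e\<^sup>2:] - p * p) t" if "t \<in> real_spectrum T" for t
      using power_mono [OF p [OF that], of 2] by (simp add: power2_eq_square)
  qed
  also have "\<dots> = (e * norm x)\<^sup>2 - (norm (poly_op p T x))\<^sup>2"
    by (simp add: poly_op_diff poly_op_const poly_op_mult blinfun.bilinear_simps inner_simps
        power_mult_distrib selfadj_opD [OF selfadj_op_poly [OF T]] flip: dot_square_norm)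
  finally show "norm (poly_op p T x) \<le> e * norm x"
    using e by (intro power2_le_imp_le [of "norm (poly_op p T x)"]) auto
qed

subsection \<open>The continuous functional calculus\<close>

text \<open>Justifies the definite description: the norm estimate makes the sequence Cauchy, and two
  sequences approximating \<open>f\<close> have differences that tend to 0.\<close>

lemma op_fun_tendsto:
  assumes T: "selfadj_op T"
    and p: "uniform_limit (real_spectrum T) (\<lambda>n. poly (p n)) f sequentially"
  shows "(\<lambda>n. poly_op (p n) T) \<longlonglongrightarrow> op_fun f T"
proof -
  have "Cauchy (\<lambda>n. poly_op (p n) T)"
  proof (rule metric_CauchyI)
    fix e :: real
    assume e: "0 < e"
    have "uniformly_Cauchy_on (real_spectrum T) (\<lambda>n. poly (p n))"
      using p by (intro uniformly_convergent_Cauchy) (auto simp: uniformly_convergent_on_def)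
    then obtain M where M: "\<And>x m n. \<lbrakk>x \<in> real_spectrum T; M \<le> m; M \<le> n\<rbrakk>
        \<Longrightarrow> dist (poly (p m) x) (poly (p n) x) < e / 2"
      using e unfolding uniformly_Cauchy_on_def by (meson half_gt_zero)
    have "dist (poly_op (p m) T) (poly_op (p n) T) < e" if "M \<le> m" "M \<le> n" for m n
    proof -
      have "norm (poly_op (p m - p n) T) \<le> e / 2"
        using e less_imp_le [OF M [OF _ that]] by (intro poly_op_norm_le [OF T]) (auto simp: dist_real_def)
      then show ?thesis
        using e by (simp add: dist_norm poly_op_diff)
    qed
    then show "\<exists>M. \<forall>m\<ge>M. \<forall>n\<ge>M. dist (poly_op (p m) T) (poly_op (p n) T) < e"
      by blast
  qed
  then obtain C where C: "(\<lambda>n. poly_op (p n) T) \<longlonglongrightarrow> C"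
    by (auto simp: Cauchy_convergent_iff convergent_def)
  have all: "(\<lambda>n. poly_op (q n) T) \<longlonglongrightarrow> C"
    if q: "uniform_limit (real_spectrum T) (\<lambda>n. poly (q n)) f sequentially" for q
  proof -
    have lim: "uniform_limit (real_spectrum T) (\<lambda>n t. poly (q n) t - poly (p n) t) (\<lambda>t. f t - f t) sequentially"
      by (intro uniform_limit_minus q p)
    have "(\<lambda>n. poly_op (q n - p n) T) \<longlonglongrightarrow> 0"
    proof (rule tendstoI)
      fix e :: real
      assume e: "0 < e"
      have "\<forall>\<^sub>F n in sequentially. \<forall>t\<in>real_spectrum T. \<bar>poly (q n) t - poly (p n) t\<bar> < e / 2"
        using uniform_limitD [OF lim, of "e / 2"] e by (simp add: dist_real_def)
      then show "\<forall>\<^sub>F n in sequentially. dist (poly_op (q n - p n) T) 0 < e"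
      proof eventually_elim
        case (elim n)
        then have "norm (poly_op (q n - p n) T) \<le> e / 2"
          using e by (intro poly_op_norm_le [OF T]) (auto intro: less_imp_le)
        then show ?case
          using e by simp
      qed
    qed
    from tendsto_add [OF this C] show ?thesis
      by (simp add: poly_op_diff)
  qed
  \<comment> \<open>Uniqueness rests on the given \<open>p\<close>: without an approximating
    sequence the defining condition would be vacuous.\<close>
  have "op_fun f T = C"
    unfolding op_fun_def real_spectrum_def [symmetric]
  proof (rule the_equality)
    fix D
    assume "\<forall>p. uniform_limit (real_spectrum T) (\<lambda>n. poly (p n)) f sequentially
        \<longrightarrow> (\<lambda>n. poly_op (p n) T) \<longlonglongrightarrow> D"
    then show "D = C"
      using p C LIMSEQ_unique by blast
  qed (use all in blast)
  then show ?thesis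
    using C by simp
qed

text \<open>Weierstrass approximation, with accuracy \<open>1 / (n + 1)\<close> at index
  \<open>n\<close>.\<close>

lemma poly_uniform_approximation:
  fixes f :: "real \<Rightarrow> real"
  assumes f: "continuous_on {a..b} f"
  obtains p where "uniform_limit {a..b} (\<lambda>n. poly (p n)) f sequentially"
proof -
  have ex: "\<exists>p. \<forall>t\<in>{a..b}. \<bar>f t - poly p t\<bar> < inverse (real (Suc n))" for n
  proof -
    obtain g where g: "real_polynomial_function g"
        "\<And>t. t \<in> {a..b} \<Longrightarrow> \<bar>f t - g t\<bar> < inverse (real (Suc n))"
      using Stone_Weierstrass_real_polynomial_function [OF compact_Icc f] by (metis inverse_positive_iff_positive of_nat_0_less_iff zero_less_Suc)
    then obtain c k where "g = (\<lambda>t. \<Sum>i\<le>k. c i * t ^ i)"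
      by (auto simp: real_polynomial_function_iff_sum)
    then have "g = poly (\<Sum>i\<le>k. monom (c i) i)"
      by (simp add: fun_eq_iff poly_sum poly_monom)
    then show ?thesis
      using g(2) by blast
  qed
  then obtain p where p: "\<bar>f t - poly (p n) t\<bar> < inverse (real (Suc n))" if "t \<in> {a..b}" for n t
    by metis
  have "uniform_limit {a..b} (\<lambda>n. poly (p n)) f sequentially"
  proof (rule uniform_limitI)
    fix e :: real
    assume "0 < e"
    then have "\<forall>\<^sub>F n in sequentially. inverse (real (Suc n)) < e"
      using LIMSEQ_inverse_real_of_nat order_tendstoD(2) by blast
    then show "\<forall>\<^sub>F n in sequentially. \<forall>t\<in>{a..b}. dist (poly (p n) t) (f t) < e"
    proof eventually_elim
      case (elim n)
      then show ?case
        using p [of _ n] by (force simp: dist_real_def abs_minus_commute)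
    qed
  qed
  then show ?thesis by (rule that)
qed

text \<open>Working on a compact interval around the spectrum makes Weierstrass approximation and
  compactness arguments directly available.\<close>

locale selfadj_on_interval =
  fixes T :: "'a::complex_hilbert_space \<Rightarrow>\<^sub>L 'a" and a b :: real
  assumes selfadj: "selfadj_op T" and spectrum: "real_spectrum T \<subseteq> {a..b}"
begin

lemma op_fun_tendsto_interval:
  "uniform_limit {a..b} (\<lambda>n. poly (p n)) f sequentially \<Longrightarrow> (\<lambda>n. poly_op (p n) T) \<longlonglongrightarrow> op_fun f T"
  using op_fun_tendsto [OF selfadj] uniform_limit_on_subset [OF _ spectrum] by blast

lemma op_fun_cong:
  assumes "\<And>t. t \<in> {a..b} \<Longrightarrow> f t = g t"
  shows "op_fun f T = op_fun g T"
proof -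
  have "uniform_limit (real_spectrum T) (\<lambda>n. poly (p n)) f sequentially
      = uniform_limit (real_spectrum T) (\<lambda>n. poly (p n)) g sequentially" for p :: "nat \<Rightarrow> real poly"
    using assms spectrum by (intro uniform_limit_cong') auto
  then show ?thesis
    by (simp add: op_fun_def flip: real_spectrum_def)
qed

lemma op_fun_poly: "op_fun (poly p) T = poly_op p T"
proof -
  have "(\<lambda>n. poly_op p T) \<longlonglongrightarrow> op_fun (poly p) T"
    by (rule op_fun_tendsto_interval) (simp add: uniform_limit_const)
  then show ?thesis
    by (simp add: LIMSEQ_const_iff)
qed

lemma op_fun_const: "op_fun (\<lambda>t. c) T = c *\<^sub>R id_blinfun"
  using op_fun_cong [of "\<lambda>t. c" "poly [:c:]"] by (simp add: op_fun_poly poly_op_const)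

lemma op_fun_ident: "op_fun (\<lambda>t. t) T = T"
  using op_fun_cong [of "\<lambda>t. t" "poly [:0, 1:]"] by (simp add: op_fun_poly poly_op_ident)

lemma op_fun_add:
  assumes "continuous_on {a..b} f" "continuous_on {a..b} g"
  shows "op_fun (\<lambda>t. f t + g t) T = op_fun f T + op_fun g T"
proof -
  obtain p q where p: "uniform_limit {a..b} (\<lambda>n. poly (p n)) f sequentially"
    and q: "uniform_limit {a..b} (\<lambda>n. poly (q n)) g sequentially"
    using assms poly_uniform_approximation by metis
  have "(\<lambda>n. poly_op (p n + q n) T) \<longlonglongrightarrow> op_fun (\<lambda>t. f t + g t) T"
    using uniform_limit_add [OF p q] by (intro op_fun_tendsto_interval) (simp add: uniform_limit_iff)
  moreover have "(\<lambda>n. poly_op (p n + q n) T) \<longlonglongrightarrow> op_fun f T + op_fun g T"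
    unfolding poly_op_add by (intro tendsto_add op_fun_tendsto_interval p q)
  ultimately show ?thesis
    by (rule LIMSEQ_unique)
qed

lemma op_fun_mult:
  assumes "continuous_on {a..b} f" "continuous_on {a..b} g"
  shows "op_fun (\<lambda>t. f t * g t) T = op_fun f T o\<^sub>L op_fun g T"
proof -
  obtain p q where p: "uniform_limit {a..b} (\<lambda>n. poly (p n)) f sequentially"
    and q: "uniform_limit {a..b} (\<lambda>n. poly (q n)) g sequentially"
    using assms poly_uniform_approximation by metis
  \<comment> \<open>Products of uniformly convergent sequences converge uniformly when the limits
    are bounded.\<close>
  have "bounded (f ` {a..b})" "bounded (g ` {a..b})"
    using assms by (auto intro!: compact_imp_bounded compact_continuous_image)
  then have "(\<lambda>n. poly_op (p n * q n) T) \<longlonglongrightarrow> op_fun (\<lambda>t. f t * g t) T"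
    using uniform_lim_mult [OF p q] by (intro op_fun_tendsto_interval) (simp add: uniform_limit_iff)
  moreover have "(\<lambda>n. poly_op (p n * q n) T) \<longlonglongrightarrow> (op_fun f T o\<^sub>L op_fun g T)"
    unfolding poly_op_mult
    by (intro blinfun_compose.tendsto
        op_fun_tendsto_interval p q)
  ultimately show ?thesis
    by (rule LIMSEQ_unique)
qed

lemma op_fun_scaleR:
  "continuous_on {a..b} f \<Longrightarrow> op_fun (\<lambda>t. c * f t) T = c *\<^sub>R op_fun f T"
  using op_fun_mult [of "\<lambda>t. c" f]
  by (auto intro!: blinfun_eqI simp: op_fun_const blinfun.bilinear_simps)

lemma op_fun_diff:
  assumes "continuous_on {a..b} f" "continuous_on {a..b} g"
  shows "op_fun (\<lambda>t. f t - g t) T = op_fun f T - op_fun g T"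
proof -
  have "op_fun (\<lambda>t. f t + (- 1) * g t) T = op_fun f T + op_fun (\<lambda>t. (- 1) * g t) T"
    using assms by (intro op_fun_add continuous_intros)
  also have "op_fun (\<lambda>t. (- 1) * g t) T = (- 1) *\<^sub>R op_fun g T"
    by (rule op_fun_scaleR [OF assms(2)])
  finally show ?thesis by simp
qed

text \<open>Complex linearity and symmetry both survive pointwise limits of
  \<open>poly_op (p n) T\<close>.\<close>

lemma selfadj_op_fun:
  assumes "continuous_on {a..b} f"
  shows "selfadj_op (op_fun f T)"
proof -
  obtain p where "uniform_limit {a..b} (\<lambda>n. poly (p n)) f sequentially"
    using assms poly_uniform_approximation by blast
  then have lim: "(\<lambda>n. poly_op (p n) T) \<longlonglongrightarrow> op_fun f T"
    by (rule op_fun_tendsto_interval)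
  have lim': "(\<lambda>n. poly_op (p n) T x) \<longlonglongrightarrow> op_fun f T x" for x
    by (intro blinfun.tendsto lim tendsto_const)
  show ?thesis
  proof (rule selfadj_opI)
    show "clinear_op (op_fun f T)"
      unfolding clinear_op_def
    proof (intro allI)
      fix c x
      have "(\<lambda>n. c *\<^sub>C poly_op (p n) T x) \<longlonglongrightarrow> c *\<^sub>C op_fun f T x"
        by (rule bounded_linear.tendsto [OF bounded_linear_scaleC lim'])
      moreover have "c *\<^sub>C poly_op (p n) T x = poly_op (p n) T (c *\<^sub>C x)" for n
        using selfadj_op_clinear [OF selfadj_op_poly [OF selfadj]] by (simp add: clinear_op_def)
      ultimately have "(\<lambda>n. poly_op (p n) T (c *\<^sub>C x)) \<longlonglongrightarrow> c *\<^sub>C op_fun f T x"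
        by simp
      then show "op_fun f T (c *\<^sub>C x) = c *\<^sub>C op_fun f T x"
        by (rule LIMSEQ_unique [OF lim'])
    qed
    fix x y
    have "(\<lambda>n. inner x (poly_op (p n) T y)) \<longlonglongrightarrow> inner x (op_fun f T y)"
      by (rule tendsto_inner [OF tendsto_const lim'])
    then have "(\<lambda>n. inner (poly_op (p n) T x) y) \<longlonglongrightarrow> inner x (op_fun f T y)"
      by (simp only: selfadj_opD [OF selfadj_op_poly [OF selfadj]])
    then show "inner x (op_fun f T y) = inner (op_fun f T x) y"
      using LIMSEQ_unique tendsto_inner [OF lim' tendsto_const] by blast
  qed
qed

lemma pos_op_fun:
  assumes f: "continuous_on {a..b} f" and pos: "\<And>t. t \<in> {a..b} \<Longrightarrow> 0 \<le> f t"
  shows "pos_op (op_fun f T)"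
proof -
  \<comment> \<open>\<open>f(T)\<close> is the square of a self-adjoint operator.\<close>
  have s: "continuous_on {a..b} (\<lambda>t. sqrt (f t))"
    by (intro continuous_intros f)
  have "op_fun f T = op_fun (\<lambda>t. sqrt (f t) * sqrt (f t)) T"
    using pos by (intro op_fun_cong) simp
  also have "\<dots> = op_fun (\<lambda>t. sqrt (f t)) T o\<^sub>L op_fun (\<lambda>t. sqrt (f t)) T"
    by (rule op_fun_mult [OF s s])
  finally have "inner x (op_fun f T x) = (norm (op_fun (\<lambda>t. sqrt (f t)) T x))\<^sup>2" for x
    by (simp add: selfadj_opD [OF selfadj_op_fun [OF s]] power2_norm_eq_inner)
  then show ?thesis
    using selfadj_op_fun [OF f] by (simp add: pos_op_iff)
qed

text \<open>The source of the equality cases: a nonnegative function whose only possible zero is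
  \<open>c\<close> can annihilate \<open>T\<close> only if \<open>T\<close> is the scalar
  \<open>c\<close>.\<close>

lemma op_fun_eq_0_imp_scalar:
  assumes h: "continuous_on {a..b} h" and pos: "\<And>t. t \<in> {a..b} \<Longrightarrow> 0 \<le> h t"
    and zero: "\<And>t. t \<in> {a..b} \<Longrightarrow> h t = 0 \<Longrightarrow> t = c"
    and hT: "op_fun h T = 0"
  shows "T = c *\<^sub>R id_blinfun"
proof -
  \<comment> \<open>Away from \<open>c\<close>, compactness bounds \<open>h\<close> below; applied to \<open>T\<close> this gives \<open>\<parallel>(T - c) x\<parallel>\<^sup>2 \<le> e \<parallel>x\<parallel>\<^sup>2\<close>.\<close>
  have bound: "\<exists>N\<ge>0. \<forall>t\<in>{a..b}. (t - c) * (t - c) \<le> e + N * h t" if e: "0 < e" for e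
  proof -
    define S where "S = {t \<in> {a..b}. e \<le> (t - c) * (t - c)}"
    have "S = {a..b} \<inter> (\<lambda>t. (t - c) * (t - c)) -` {e..}"
      by (auto simp: S_def)
    moreover have "closed ({a..b} \<inter> (\<lambda>t. (t - c) * (t - c)) -` {e..})"
      by (intro continuous_closed_preimage continuous_intros)
    ultimately have "compact S"
      by (metis compact_Icc compact_Int_closed inf.absorb_iff2 inf_le1)
    show ?thesis
    proof (cases "S = {}")
      case True
      have "(t - c) * (t - c) \<le> e" if "t \<in> {a..b}" for t
      proof (rule ccontr)
        assume "\<not> (t - c) * (t - c) \<le> e"
        then have "t \<in> S"
          using that by (simp add: S_def)
        then show False
          using True by simp
      qed
      then show ?thesis
        by (intro exI [of _ 0]) simp
    next
      case False
      obtain m where m: "m \<in> S" "\<And>t. t \<in> S \<Longrightarrow> h m \<le> h t"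
        using continuous_attains_inf [OF \<open>compact S\<close> False continuous_on_subset [OF h]]
        by (metis (no_types, lifting) S_def mem_Collect_eq subsetI)
      have hm: "0 < h m"
      proof -
        have "m \<in> {a..b}" "m \<noteq> c"
          using m(1) e by (auto simp: S_def)
        then show ?thesis
          using pos [of m] zero [of m] by linarith
      qed
      obtain B where B: "\<And>t. t \<in> S \<Longrightarrow> (t - c) * (t - c) \<le> B"
      proof -
        have "continuous_on S (\<lambda>t. (t - c) * (t - c))"
          by (intro continuous_intros)
        then show ?thesis
          using continuous_attains_sup [OF \<open>compact S\<close> False] that by blast
      qed
      have B0: "0 \<le> B"
        using B [OF m(1)] by (meson order_trans zero_le_square)
      show ?thesis
      \<comment> \<open>On \<open>S\<close> the minimum \<open>h m\<close> gives
        \<open>B / h m * h t \<ge> B\<close>, which dominates the square; off \<open>S\<close> the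
        square is below \<open>e\<close>.\<close>
      proof (intro exI [of _ "B / h m"] conjI ballI)
        fix t
        assume t: "t \<in> {a..b}"
        have "0 \<le> B / h m * h t"
          using B0 hm pos [OF t] by simp
        moreover have "B \<le> B / h m * h t" if "t \<in> S"
          using mult_left_mono [OF m(2) [OF that] B0] hm by (simp add: field_simps)
        ultimately show "(t - c) * (t - c) \<le> e + B / h m * h t"
        proof (cases "t \<in> S")
          case False
          then have "(t - c) * (t - c) \<le> e"
            using t by (simp add: S_def)
          then show ?thesis
            using \<open>0 \<le> B / h m * h t\<close> by linarith
        qed (use e B [of t] in linarith)
      qed (use B0 hm in simp)
    qed
  qed
  have "T x = c *\<^sub>R x" for x
  proof -
    let ?D = "T - c *\<^sub>R id_blinfun"
    have D: "selfadj_op ?D"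
      by (intro selfadj_op_diff selfadj_op_scaleR selfadj selfadj_op_id)
    have opD: "op_fun (\<lambda>t. (t - c) * (t - c)) T = ?D o\<^sub>L ?D"
      by (subst op_fun_mult) (auto intro!: continuous_intros simp: op_fun_diff op_fun_ident op_fun_const)
    have le: "(norm (?D x))\<^sup>2 \<le> e * (norm x)\<^sup>2" if e: "0 < e" for e
    proof -
      obtain N where N: "0 \<le> N" "\<And>t. t \<in> {a..b} \<Longrightarrow> (t - c) * (t - c) \<le> e + N * h t"
        using bound [OF e] by blast
      have "pos_op (op_fun (\<lambda>t. (e + N * h t) - (t - c) * (t - c)) T)"
        using N h by (intro pos_op_fun continuous_intros) auto
      also have "op_fun (\<lambda>t. (e + N * h t) - (t - c) * (t - c)) T = e *\<^sub>R id_blinfun - (?D o\<^sub>L ?D)"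
      proof -
        have "op_fun (\<lambda>t. (e + N * h t) - (t - c) * (t - c)) T
            = op_fun (\<lambda>t. e + N * h t) T - op_fun (\<lambda>t. (t - c) * (t - c)) T"
          by (intro op_fun_diff continuous_intros h)
        moreover have "op_fun (\<lambda>t. e + N * h t) T = op_fun (\<lambda>t. e) T + op_fun (\<lambda>t. N * h t) T"
          by (intro op_fun_add continuous_intros h)
        ultimately show ?thesis
          by (simp add: op_fun_scaleR [OF h] op_fun_const hT opD)
      qed
      finally have "0 \<le> inner x ((e *\<^sub>R id_blinfun - (?D o\<^sub>L ?D)) x)"
        by (rule pos_op_inner)
      also have "\<dots> = e * (norm x)\<^sup>2 - inner x (?D (?D x))"
        by (simp only: blinfun.diff_left blinfun.scaleR_left blinfun_apply_id_blinfun
            blinfun_apply_blinfun_compose inner_diff_right inner_scaleR_right dot_square_norm)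
      also have "\<dots> = e * (norm x)\<^sup>2 - (norm (?D x))\<^sup>2"
        by (simp only: selfadj_opD [OF D] dot_square_norm)
      finally show ?thesis by simp
    qed
    have "(norm (?D x))\<^sup>2 \<le> 0"
    proof (rule field_le_epsilon)
      fix e :: real
      assume e: "0 < e"
      \<comment> \<open>Dividing by this rather than by \<open>(norm x)\<^sup>2\<close> also covers
        \<open>x = 0\<close>.\<close>
      have pos: "0 < (norm x)\<^sup>2 + 1"
        by (simp add: add_nonneg_pos)
      have "(norm (?D x))\<^sup>2 \<le> e / ((norm x)\<^sup>2 + 1) * (norm x)\<^sup>2"
        using e pos by (intro le) simp
      also have "\<dots> \<le> e"
        using e pos by (simp add: field_simps)
      finally show "(norm (?D x))\<^sup>2 \<le> 0 + e" by simp
    qed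
    then show ?thesis
      by (simp add: blinfun.bilinear_simps)
  qed
  then show ?thesis
    by (intro blinfun_eqI) (simp add: blinfun.bilinear_simps)
qed

end

lemma (in selfadj_on_interval) op_fun_linear_combination:
  assumes "continuous_on {a..b} f" "continuous_on {a..b} g"
  shows "op_fun (\<lambda>t. p * f t + q * g t + r) T = p *\<^sub>R op_fun f T + q *\<^sub>R op_fun g T + r *\<^sub>R id_blinfun"
proof -
  have "op_fun (\<lambda>t. p * f t + q * g t + r) T = op_fun (\<lambda>t. p * f t + q * g t) T + op_fun (\<lambda>t. r) T"
    by (intro op_fun_add continuous_intros assms)
  moreover have "op_fun (\<lambda>t. p * f t + q * g t) T = op_fun (\<lambda>t. p * f t) T + op_fun (\<lambda>t. q * g t) T"
    by (intro op_fun_add continuous_intros assms)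
  ultimately show ?thesis
    by (simp add: op_fun_scaleR assms op_fun_const)
qed

text \<open>The spectrum lies in \<open>{c}\<close>, and on the degenerate interval
  \<open>{c..c}\<close> every function agrees with a constant.\<close>

lemma op_fun_scalar: "op_fun f (c *\<^sub>R id_blinfun) = f c *\<^sub>R id_blinfun"
proof -
  have "t = c" if "t \<in> real_spectrum (c *\<^sub>R id_blinfun :: 'a \<Rightarrow>\<^sub>L 'a)" for t
  proof (rule ccontr)
    assume "t \<noteq> c"
    then have "invertible_op (scalar_op (complex_of_real (c - t)) :: 'a \<Rightarrow>\<^sub>L 'a)"
      by (intro invertible_op_scalar) (simp del: of_real_diff)
    then show False
      using that by (simp add: real_spectrum_def op_spectrum_def scalar_op_of_real
          scaleR_left_diff_distrib del: of_real_diff)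
  qed
  then interpret selfadj_on_interval "c *\<^sub>R id_blinfun :: 'a \<Rightarrow>\<^sub>L 'a" c c
    by unfold_locales (auto intro: selfadj_op_scaleR)
  have "op_fun f (c *\<^sub>R id_blinfun :: 'a \<Rightarrow>\<^sub>L 'a) = op_fun (\<lambda>t. f c) (c *\<^sub>R id_blinfun)"
    by (rule op_fun_cong) simp
  then show ?thesis
    by (simp add: op_fun_const)
qed

subsection \<open>Powers of positive invertible operators\<close>

text \<open>The coercivity constant serves as left end; its positivity makes all real powers
  continuous on the interval.\<close>

lemma pos_invertible_interval:
  assumes "pos_op T" "invertible_op T"
  obtains a b where "0 < a" "selfadj_on_interval T a b"
proof -
  obtain c where c: "0 < c" "\<And>x. c * (norm x)\<^sup>2 \<le> inner x (T x)"
    using pos_invertible_coercive [OF assms] by blast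
  have hi: "inner x (T x) \<le> norm T * (norm x)\<^sup>2" for x
  proof -
    have "inner x (T x) \<le> norm x * norm (T x)"
      by (rule norm_cauchy_schwarz)
    also have "\<dots> \<le> norm x * (norm T * norm x)"
      by (intro mult_left_mono norm_blinfun) simp
    finally show ?thesis
      by (simp add: power2_eq_square mult_ac)
  qed
  have "real_spectrum T \<subseteq> {c..norm T}"
  proof
    fix t
    assume "t \<in> real_spectrum T"
    then have "complex_of_real t \<in> op_spectrum T"
      by (simp add: real_spectrum_def)
    then show "t \<in> {c..norm T}"
      by (rule selfadj_spectrum_bounds [OF pos_op_selfadj [OF assms(1)] _ c(2) hi])
  qed
  then show ?thesis
    using c(1) assms(1) that by (simp add: selfadj_on_interval_def pos_op_selfadj)
qed

context
  fixes T :: "'a::complex_hilbert_space \<Rightarrow>\<^sub>L 'a"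
  assumes T: "pos_op T" "invertible_op T"
begin

lemma selfadj_op_powr: "selfadj_op (op_powr T s)"
proof -
  obtain a b where ab: "0 < a" "selfadj_on_interval T a b"
    using pos_invertible_interval [OF T] .
  show ?thesis
    unfolding op_powr_def using ab(1)
    by (intro selfadj_on_interval.selfadj_op_fun [OF ab(2)] continuous_intros) auto
qed

lemma op_powr_compose: "op_powr T r o\<^sub>L op_powr T s = op_powr T (r + s)"
proof -
  obtain a b where ab: "0 < a" "selfadj_on_interval T a b"
    using pos_invertible_interval [OF T] .
  have "op_fun (\<lambda>x. x powr r * x powr s) T = op_powr T r o\<^sub>L op_powr T s"
    unfolding op_powr_def using ab(1)
    by (intro selfadj_on_interval.op_fun_mult [OF ab(2)] continuous_intros) auto
  then show ?thesis
    by (simp add: op_powr_def powr_add)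
qed

lemma op_powr_zero: "op_powr T 0 = id_blinfun"
proof -
  obtain a b where ab: "0 < a" "selfadj_on_interval T a b"
    using pos_invertible_interval [OF T] .
  then have "op_powr T 0 = op_fun (\<lambda>t. 1) T"
    unfolding op_powr_def by (intro selfadj_on_interval.op_fun_cong [OF ab(2)]) auto
  then show ?thesis
    by (simp add: selfadj_on_interval.op_fun_const [OF ab(2)])
qed

lemma op_powr_one: "op_powr T 1 = T"
proof -
  obtain a b where ab: "0 < a" "selfadj_on_interval T a b"
    using pos_invertible_interval [OF T] .
  then have "op_powr T 1 = op_fun (\<lambda>t. t) T"
    unfolding op_powr_def by (intro selfadj_on_interval.op_fun_cong [OF ab(2)]) auto
  then show ?thesis
    by (simp add: selfadj_on_interval.op_fun_ident [OF ab(2)])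
qed

lemma invertible_op_powr: "invertible_op (op_powr T s)"
  unfolding invertible_op_def
  by (intro exI [of _ "op_powr T (- s)"])
     (simp add: op_powr_compose op_powr_zero selfadj_op_clinear selfadj_op_powr)

end

subsection \<open>The scalar inequality\<close>

lemma powr_le_tangent:
  fixes y l :: real
  assumes y: "0 < y" and l: "0 < l" "l \<le> 1"
  shows "(y powr l - 1) / l \<le> y - 1"
    and "l < 1 \<Longrightarrow> (y powr l - 1) / l = y - 1 \<Longrightarrow> y = 1"
proof -
  \<comment> \<open>Jensen for the logarithm at the points \<open>y\<close> and \<open>1\<close> with mean \<open>m\<close>.\<close>
  define m where "m = l * y + (1 - l)"
  have m: "0 < m"
    using y l by (simp add: m_def add_pos_nonneg)
  have ln1: "ln (y / m) \<le> y / m - 1" and ln2: "ln (1 / m) \<le> 1 / m - 1"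
    using y m by (intro ln_le_minus_one; simp)+
  \<comment> \<open>The weighted tangent bounds cancel because \<open>m\<close> is the weighted
    mean.\<close>
  have zero: "l * (y / m - 1) + (1 - l) * (1 / m - 1) = 0"
    using m by (simp add: field_simps) (simp add: m_def algebra_simps)
  have split: "l * ln y - ln m = l * ln (y / m) + (1 - l) * ln (1 / m)"
    using y m by (simp add: ln_div algebra_simps)
  have "l * ln (y / m) + (1 - l) * ln (1 / m) \<le> l * (y / m - 1) + (1 - l) * (1 / m - 1)"
    using l ln1 ln2 by (intro add_mono mult_left_mono) auto
  then have le: "l * ln y \<le> ln m"
    using split zero by linarith
  have powr: "y powr l = exp (l * ln y)"
    using y by (simp add: powr_def)
  have "y powr l \<le> m"
    using le m by (simp add: powr ln_ge_iff)
  then show "(y powr l - 1) / l \<le> y - 1"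
    using l by (simp add: m_def field_simps)
  show "y = 1" if "l < 1" "(y powr l - 1) / l = y - 1"
  proof -
    have "y powr l = m"
      using that l by (simp add: m_def field_simps)
    then have "l * ln y = ln m"
      by (metis ln_exp powr)
    then have "l * ln (y / m) + (1 - l) * ln (1 / m) = l * (y / m - 1) + (1 - l) * (1 / m - 1)"
      using split zero by linarith
    moreover have "(1 - l) * ln (1 / m) \<le> (1 - l) * (1 / m - 1)" "l * ln (y / m) \<le> l * (y / m - 1)"
      using l ln1 ln2 by (auto intro: mult_left_mono)
    \<comment> \<open>Two inequalities whose sums agree are both equalities; with positive weights,
      \<open>ln z = z - 1\<close> then forces each ratio to be 1.\<close>
    ultimately have "(1 - l) * ln (1 / m) = (1 - l) * (1 / m - 1)"
      "l * ln (y / m) = l * (y / m - 1)"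
      by linarith+
    then have "ln (1 / m) = 1 / m - 1" "ln (y / m) = y / m - 1"
      using that(1) l by simp_all
    then have "1 / m = 1" "y / m = 1"
      using y m by (intro ln_eq_minus_one; simp)+
    then show ?thesis
      using m by simp
  qed
qed

subsection \<open>The operator relative to a pair\<close>

locale pos_invertible_pair =
  fixes A B :: "'a::complex_hilbert_space \<Rightarrow>\<^sub>L 'a"
  assumes A: "pos_op A" "invertible_op A" and B: "pos_op B" "invertible_op B"
begin

definition R :: "'a \<Rightarrow>\<^sub>L 'a" where "R = op_powr A (1/2)"
definition Q :: "'a \<Rightarrow>\<^sub>L 'a" where "Q = op_powr A (-1/2)"
definition X :: "'a \<Rightarrow>\<^sub>L 'a" where "X = Q o\<^sub>L B o\<^sub>L Q"

lemma R_R: "R (R x) = A x"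
  using op_powr_compose [OF A, of "1/2" "1/2"] op_powr_one [OF A]
  by (simp add: R_def flip: blinfun_apply_blinfun_compose)

lemma R_Q [simp]: "R (Q x) = x" and Q_R [simp]: "Q (R x) = x"
  using op_powr_compose [OF A, of "1/2" "-1/2"] op_powr_compose [OF A, of "-1/2" "1/2"]
    op_powr_zero [OF A]
  by (simp_all add: R_def Q_def flip: blinfun_apply_blinfun_compose)

lemma X_pos: "pos_op X"
  unfolding X_def Q_def by (intro pos_op_conjugate selfadj_op_powr A B)

lemma X_invertible: "invertible_op X"
  unfolding X_def Q_def by (intro invertible_op_compose invertible_op_powr A B)

text \<open>\<open>Q\<close> inverts \<open>R\<close> on both sides, so nothing is lost in passing
  from \<open>Y\<close> to its congruence.\<close>

lemma congruence_eq_0_iff: "R o\<^sub>L Y o\<^sub>L R = 0 \<longleftrightarrow> Y = 0"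
proof
  assume "R o\<^sub>L Y o\<^sub>L R = 0"
  then have "Q ((R o\<^sub>L Y o\<^sub>L R) (Q x)) = 0" for x
    by simp
  then show "Y = 0"
    by (intro blinfun_eqI) simp
qed (auto intro!: blinfun_eqI)

lemma congruence_id: "R o\<^sub>L id_blinfun o\<^sub>L R = A"
  by (rule blinfun_eqI) (simp add: R_R)

lemma congruence_X: "R o\<^sub>L X o\<^sub>L R = B"
  by (rule blinfun_eqI) (simp add: X_def)

lemma X_eq_scalar_iff: "X = c *\<^sub>R id_blinfun \<longleftrightarrow> B = c *\<^sub>R A"
proof -
  have "R o\<^sub>L (X - c *\<^sub>R id_blinfun) o\<^sub>L R = B - c *\<^sub>R A"
    by (simp only: blinfun_compose.bilinear_simps congruence_id congruence_X)
  then show ?thesis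
    using congruence_eq_0_iff [of "X - c *\<^sub>R id_blinfun"] by simp
qed

lemma op_sharp_eq: "op_sharp \<mu> A B = R o\<^sub>L op_fun (\<lambda>t. t powr \<mu>) X o\<^sub>L R"
  by (simp add: op_sharp_def R_def Q_def X_def op_powr_def)

lemma congruence_op_fun_nonneg:
  assumes "continuous_on {0<..} f" and pos: "\<And>t. 0 < t \<Longrightarrow> 0 \<le> f t"
  shows "pos_op (R o\<^sub>L op_fun f X o\<^sub>L R)"
proof -
  obtain a b where ab: "0 < a" "selfadj_on_interval X a b"
    using pos_invertible_interval [OF X_pos X_invertible] .
  have "continuous_on {a..b} f"
    using assms(1) by (rule continuous_on_subset) (use ab(1) in auto)
  then have "pos_op (op_fun f X)"
    using ab(1) pos by (intro selfadj_on_interval.pos_op_fun [OF ab(2)]) auto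
  then show ?thesis
    unfolding R_def by (intro pos_op_conjugate selfadj_op_powr A)
qed

lemma congruence_op_fun_eq_0_iff:
  assumes "continuous_on {0<..} f" and zero: "\<And>t. 0 < t \<Longrightarrow> f t = 0 \<longleftrightarrow> t = c" and c: "0 < c"
  shows "R o\<^sub>L op_fun f X o\<^sub>L R = 0 \<longleftrightarrow> B = c *\<^sub>R A"
proof -
  obtain a b where ab: "0 < a" "selfadj_on_interval X a b"
    using pos_invertible_interval [OF X_pos X_invertible] .
  interpret selfadj_on_interval X a b by fact
  have f: "continuous_on {a..b} f"
    using assms(1) by (rule continuous_on_subset) (use ab(1) in auto)
  have "op_fun f X = 0 \<longleftrightarrow> X = c *\<^sub>R id_blinfun"
  proof
    assume "op_fun f X = 0"
    \<comment> \<open>Squaring supplies the nonnegativity that \<open>op_fun_eq_0_imp_scalar\<close>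
      asks for, so \<open>f\<close> may change sign, as it does for the entropy itself.\<close>
    then have "op_fun (\<lambda>t. f t * f t) X = 0"
      using op_fun_mult [OF f f] by simp
    then show "X = c *\<^sub>R id_blinfun"
      using ab(1) zero by (intro op_fun_eq_0_imp_scalar [OF continuous_on_mult [OF f f]]) auto
  next
    assume "X = c *\<^sub>R id_blinfun"
    then show "op_fun f X = 0"
      using zero [OF c] by (simp add: op_fun_scalar)
  qed
  then show ?thesis
    by (simp add: congruence_eq_0_iff X_eq_scalar_iff)
qed

text \<open>Translates scalar identities in \<open>t\<close> into operator identities, with the
  constant term becoming a multiple of \<open>A\<close>.\<close>

lemma congruence_linear_combination:
  assumes f: "continuous_on {0<..} f" and g: "continuous_on {0<..} g"
  shows "R o\<^sub>L op_fun (\<lambda>t. p * f t + q * g t + r) X o\<^sub>L R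
    = p *\<^sub>R (R o\<^sub>L op_fun f X o\<^sub>L R) + q *\<^sub>R (R o\<^sub>L op_fun g X o\<^sub>L R) + r *\<^sub>R A"
proof -
  obtain a b where ab: "0 < a" "selfadj_on_interval X a b"
    using pos_invertible_interval [OF X_pos X_invertible] .
  have "{a..b} \<subseteq> {0<..}"
    using ab(1) by auto
  then have "continuous_on {a..b} f" "continuous_on {a..b} g"
    using f g continuous_on_subset by blast+
  then show ?thesis
    by (simp only: selfadj_on_interval.op_fun_linear_combination [OF ab(2)]
        blinfun_compose.bilinear_simps congruence_id)
qed

end

text \<open>At \<open>l = 1\<close> all three expressions reduce to \<open>B - A\<close>, so both
  inequalities are equalities for every pair; hence the equality criteria are stated for
  \<open>l < 1\<close>.\<close>

theorem theorem3p6: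
  fixes A B :: "'a::complex_hilbert_space \<Rightarrow>\<^sub>L 'a" and l \<alpha> :: real
  assumes "0 < l" and "l \<le> 1"
    and "pos_op A" and "invertible_op A"
    and "pos_op B" and "invertible_op B"
    and "0 < \<alpha>"
  shows "op_sharp l A B - (1/\<alpha>) *\<^sub>R op_sharp (l - 1) A B + ln_tsallis l (1/\<alpha>) *\<^sub>R A
          \<le>\<^sub>o\<^sub>p tsallis_entropy l A B
    \<and> tsallis_entropy l A B \<le>\<^sub>o\<^sub>p (1/\<alpha>) *\<^sub>R B - A - ln_tsallis l (1/\<alpha>) *\<^sub>R op_sharp l A B
    \<and> (l < 1 \<longrightarrow>
        (tsallis_entropy l A B = (1/\<alpha>) *\<^sub>R B - A - ln_tsallis l (1/\<alpha>) *\<^sub>R op_sharp l A B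
          \<longleftrightarrow> B = \<alpha> *\<^sub>R A))
    \<and> (l < 1 \<longrightarrow>
        (op_sharp l A B - (1/\<alpha>) *\<^sub>R op_sharp (l - 1) A B + ln_tsallis l (1/\<alpha>) *\<^sub>R A
            = tsallis_entropy l A B
          \<longleftrightarrow> A = \<alpha> *\<^sub>R B))
    \<and> (tsallis_entropy l A B = 0 \<longleftrightarrow> A = B)"
proof -
  interpret pos_invertible_pair A B
    by unfold_locales fact+
  define k where "k = ln_tsallis l (1/\<alpha>)"
  define \<psi> where "\<psi> = (\<lambda>y. y - 1 - (y powr l - 1) / l)"
  let ?left = "\<lambda>t. (1/l - 1) * t powr l + (1/\<alpha>) * t powr (l - 1) + (- (1/l) - k)"
  let ?right = "\<lambda>t. (- (k + 1/l)) * t powr l + (1/\<alpha>) * t + (1/l - 1)"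
  \<comment> \<open>The zero coefficient only fits the entropy into the shape of
    \<open>congruence_linear_combination\<close>.\<close>
  let ?zero = "\<lambda>t. (1/l) * t powr l + 0 * t + (- (1/l))"
  let ?F = "\<lambda>f. R o\<^sub>L op_fun f X o\<^sub>L R"

  have cont: "continuous_on {0<..} (\<lambda>t::real. t powr s)" for s
    by (intro continuous_intros) auto
  have cont_left: "continuous_on {0<..} ?left" and cont_right: "continuous_on {0<..} ?right"
    and cont_zero: "continuous_on {0<..} ?zero"
    by (intro continuous_intros cont)+
  have X_ident: "op_fun (\<lambda>t. t) X = X"
    by (rule pos_invertible_interval [OF X_pos X_invertible])
       (rule selfadj_on_interval.op_fun_ident)
  have F_left: "?F ?left = tsallis_entropy l A B
      - (op_sharp l A B - (1/\<alpha>) *\<^sub>R op_sharp (l - 1) A B + k *\<^sub>R A)"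
    by (subst congruence_linear_combination [OF cont cont])
       (simp add: tsallis_entropy_def algebra_simps flip: op_sharp_eq)
  have F_right: "?F ?right = (1/\<alpha>) *\<^sub>R B - A - k *\<^sub>R op_sharp l A B - tsallis_entropy l A B"
    by (subst congruence_linear_combination [OF cont continuous_on_id])
       (simp add: tsallis_entropy_def algebra_simps X_ident congruence_X flip: op_sharp_eq)
  have F_zero: "?F ?zero = tsallis_entropy l A B"
    by (subst congruence_linear_combination [OF cont continuous_on_id])
       (simp add: tsallis_entropy_def algebra_simps flip: op_sharp_eq)

  have \<psi>_nonneg: "0 \<le> \<psi> y" if "0 < y" for y
    using powr_le_tangent(1) [OF that assms(1,2)] by (simp add: \<psi>_def)
  have \<psi>_zero: "\<psi> y = 0 \<longleftrightarrow> y = 1" if "0 < y" "l < 1" for y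
    using powr_le_tangent(2) [OF that(1) assms(1,2) that(2)] by (auto simp: \<psi>_def)
  \<comment> \<open>The constants match because \<open>k + 1/l\<close> equals
    \<open>(1/\<alpha>) powr l / l\<close>. The zero \<open>1 / (\<alpha> * t) = 1\<close> lies at
    \<open>t = 1/\<alpha>\<close>.\<close>
  have left: "?left t = t powr l * \<psi> (1 / (\<alpha> * t))" if "0 < t" for t
    using that assms(1,7)
    by (simp add: \<psi>_def k_def ln_tsallis_def powr_divide powr_mult powr_diff field_simps)
  have right: "?right t = \<psi> (t / \<alpha>)" if "0 < t" for t
    using that assms(1,7)
    by (simp add: \<psi>_def k_def ln_tsallis_def powr_divide field_simps)

  have le_left: "pos_op (?F ?left)"
    using left \<psi>_nonneg assms(7) by (intro congruence_op_fun_nonneg cont_left) simp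
  have le_right: "pos_op (?F ?right)"
    using right \<psi>_nonneg assms(7) by (intro congruence_op_fun_nonneg cont_right) simp
  have eq_right: "?F ?right = 0 \<longleftrightarrow> B = \<alpha> *\<^sub>R A" if "l < 1"
    using right \<psi>_zero [OF _ that] assms(7)
    by (intro congruence_op_fun_eq_0_iff cont_right) (auto simp: field_simps)
  have eq_left: "?F ?left = 0 \<longleftrightarrow> A = \<alpha> *\<^sub>R B" if "l < 1"
  proof -
    have "?F ?left = 0 \<longleftrightarrow> B = (1/\<alpha>) *\<^sub>R A"
      using left \<psi>_zero [OF _ that] assms(7)
      by (intro congruence_op_fun_eq_0_iff cont_left) (auto simp: field_simps)
    also have "\<dots> \<longleftrightarrow> A = \<alpha> *\<^sub>R B"
      using assms(7) by auto
    finally show ?thesis .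
  qed
  \<comment> \<open>Here the scalar function is \<open>(t powr l - 1) / l\<close>, whose only
    positive zero is 1 for every admissible \<open>l\<close>, including
    \<open>l = 1\<close>.\<close>
  have eq_zero: "?F ?zero = 0 \<longleftrightarrow> B = 1 *\<^sub>R A"
  proof (rule congruence_op_fun_eq_0_iff [OF cont_zero])
    fix t :: real
    assume t: "0 < t"
    have "t powr l = 1 \<longleftrightarrow> t = 1"
      using t assms(1) by (simp add: powr_def)
    then show "?zero t = 0 \<longleftrightarrow> t = 1"
      using assms(1) by (simp add: field_simps)
  qed simp
  show ?thesis
    unfolding op_le_def k_def [symmetric]
  proof (intro conjI impI)
    show "pos_op (tsallis_entropy l A B
        - (op_sharp l A B - (1/\<alpha>) *\<^sub>R op_sharp (l - 1) A B + k *\<^sub>R A))"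
      using le_left unfolding F_left .
    show "pos_op ((1/\<alpha>) *\<^sub>R B - A - k *\<^sub>R op_sharp l A B - tsallis_entropy l A B)"
      using le_right unfolding F_right .
    show "tsallis_entropy l A B = (1/\<alpha>) *\<^sub>R B - A - k *\<^sub>R op_sharp l A B \<longleftrightarrow> B = \<alpha> *\<^sub>R A"
      if "l < 1"
      using eq_right [OF that] unfolding F_right right_minus_eq by (rule trans [OF eq_commute])
    show "op_sharp l A B - (1/\<alpha>) *\<^sub>R op_sharp (l - 1) A B + k *\<^sub>R A = tsallis_entropy l A B
        \<longleftrightarrow> A = \<alpha> *\<^sub>R B" if "l < 1"
      using eq_left [OF that] unfolding F_left right_minus_eq by (rule trans [OF eq_commute])
    show "tsallis_entropy l A B = 0 \<longleftrightarrow> A = B"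
      using eq_zero unfolding F_zero scaleR_one by (rule trans [OF _ eq_commute])
  qed
qed

end
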